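(* Let $S$ be a $C$-semigroup and let $(X,d)$ be a metric space whose topology is Polish, equipped with a continuous action of $S$. If the dynamical system $(S,X)$ is an $M$-system and $Eq(X)\neq\varnothing$, then $(S,X)$ is minimal and equicontinuous.
   Context: A topological semigroup $S$ acts continuously on $X$ if there is a jointly continuous map $S\times X\to X$, $(s,x)\mapsto sx$, with $s_1(s_2x)=(s_1s_2)x$ for all $s_1,s_2\in S$, $x\in X$; then $(S,X)$ is called a dynamical system ($S$-system). $S$ is not assumed to have an identity element. A topological space is Polish if it admits a compatible separable complete metric. $C$-semigroup: a topological semigroup $S$ such that for every $s_0\in S$ the subset $S\setminus Ss_0$ is relatively compact, i.e. its closure in $S$ is compact. The orbit of $x$ is $Sx=\{sx: s\in S\}$. The system $(S,X)$ is minimal if $\overline{Sx}=X$ for every $x\in X$. A point $x\in X$ is almost periodic if the subsystem $\overline{Sx}$ (the restriction of the action to this closed $S$-invariant set) is minimal and compact. $(S,X)$ is topologically transitive (TT) if for every pair $U,V$ of nonempty open subsets of $X$ there is $s\in S$ with $U\cap sV\neq\varnothing$. $(S,X)$ is an $M$-system if it is topologically transitive and the set of almost periodic points is dense in $X$. A point $x_0\in X$ is an equicontinuity point if for every $\varepsilon>0$ there is $\delta>0$ such that $d(x_0,x)<\delta$ implies $d(sx_0,sx)<\varepsilon$ for every $s\in S$. $Eq(X)$ denotes the set of equicontinuity points. $(S,X)$ is equicontinuous if $Eq(X)=X$. *)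

theory Defs
  imports "HOL-Analysis.Analysis"
begin

text \<open>
  The acting semigroup and the phase space are types. Neither a Hausdorff condition nor an
  identity element is required of the semigroup, so a point need not belong to its own orbit.
\<close>

definition C_semigroup :: "'s::topological_semigroup_mult itself \<Rightarrow> bool" where
  "C_semigroup _ \<longleftrightarrow> (\<forall>s0::'s. compact (closure (UNIV - range (\<lambda>s. s * s0))))"

definition polish_topology :: "'x topology \<Rightarrow> bool" where
  "polish_topology T \<longleftrightarrow> completely_metrizable_space T \<and> separable_space T"

definition continuous_action ::
    "('s::topological_semigroup_mult \<Rightarrow> 'x::topological_space \<Rightarrow> 'x) \<Rightarrow> bool" where
  "continuous_action act \<longleftrightarrow>
     continuous_on UNIV (\<lambda>(s, x). act s x) \<and>
     (\<forall>s1 s2 x. act s1 (act s2 x) = act (s1 * s2) x)"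

definition orbit :: "('s \<Rightarrow> 'x \<Rightarrow> 'x) \<Rightarrow> 'x \<Rightarrow> 'x set" where
  "orbit act x = range (\<lambda>s. act s x)"

text \<open>
  Minimality of the subsystem carried by an invariant set \<open>Y\<close>: orbit closures are taken in the
  subspace topology of \<open>Y\<close>. The whole system is the case \<open>Y = UNIV\<close>.
\<close>

definition minimal_on :: "('s \<Rightarrow> 'x::topological_space \<Rightarrow> 'x) \<Rightarrow> 'x set \<Rightarrow> bool" where
  "minimal_on act Y \<longleftrightarrow> (\<forall>x\<in>Y. (top_of_set Y) closure_of (orbit act x) = Y)"

abbreviation minimal_system :: "('s \<Rightarrow> 'x::topological_space \<Rightarrow> 'x) \<Rightarrow> bool" where
  "minimal_system act \<equiv> minimal_on act UNIV"

definition almost_periodic :: "('s \<Rightarrow> 'x::topological_space \<Rightarrow> 'x) \<Rightarrow> 'x \<Rightarrow> bool" where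
  "almost_periodic act x \<longleftrightarrow>
     minimal_on act (closure (orbit act x)) \<and> compact (closure (orbit act x))"

definition topologically_transitive :: "('s \<Rightarrow> 'x::topological_space \<Rightarrow> 'x) \<Rightarrow> bool" where
  "topologically_transitive act \<longleftrightarrow>
     (\<forall>U V. open U \<and> U \<noteq> {} \<and> open V \<and> V \<noteq> {} \<longrightarrow> (\<exists>s. U \<inter> act s ` V \<noteq> {}))"

definition M_system :: "('s \<Rightarrow> 'x::topological_space \<Rightarrow> 'x) \<Rightarrow> bool" where
  "M_system act \<longleftrightarrow>
     topologically_transitive act \<and> closure {x. almost_periodic act x} = UNIV"

definition Eq_points :: "('s \<Rightarrow> 'x::metric_space \<Rightarrow> 'x) \<Rightarrow> 'x set" where
  "Eq_points act =
     {x0. \<forall>\<epsilon>>0. \<exists>\<delta>>0. \<forall>x. dist x0 x < \<delta> \<longrightarrow> (\<forall>s. dist (act s x0) (act s x) < \<epsilon>)}"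

definition equicontinuous_system :: "('s \<Rightarrow> 'x::metric_space \<Rightarrow> 'x) \<Rightarrow> bool" where
  "equicontinuous_system act \<longleftrightarrow> Eq_points act = UNIV"

end

theory Submission
  imports Defs
begin

text \<open>
  Fix an equicontinuity point \<open>x0\<close>. Points starting near \<open>x0\<close> are shadowed by \<open>x0\<close> uniformly
  over the whole semigroup, and this transports recurrence in two ways. Transitivity moves some
  point near \<open>x0\<close> into any given open set, so the shadowing makes the orbit of \<open>x0\<close> dense
  (\<open>Eq_point_orbit_dense\<close>). An almost periodic point \<open>a\<close> near \<open>x0\<close> has a compact minimal orbit
  closure \<open>M\<close>, so finitely many elements of the semigroup suffice to move each point of \<open>M\<close>
  close to \<open>x0\<close>; by shadowing, the same finite set does so for each point of the orbit of \<open>x0\<close>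
  (\<open>Eq_point_finite_return\<close>). Because the set is finite, this property survives passing to the
  closure of the orbit of \<open>x0\<close>, which is the whole space. Hence every orbit accumulates at \<open>x0\<close>,
  and as the orbit of \<open>x0\<close> is dense, every orbit is dense.

  For equicontinuity at an arbitrary point \<open>x\<close>, choose \<open>s\<close> with \<open>s x\<close> near \<open>x0\<close>. Then a
  neighbourhood of \<open>x\<close> is also moved near \<open>x0\<close> by \<open>s\<close>, so the elements of \<open>S s\<close> are
  equicontinuous at \<open>x\<close>. The remaining elements lie in a compact set, and a compact family in a
  jointly continuous action is always equicontinuous. This is the point at which the
  \<open>C\<close>-semigroup condition enters.
\<close>

section \<open>Orbits in a continuous action\<close>

lemma act_assoc:
  assumes "continuous_action act"
  shows "act s (act t x) = act (s * t) x"
  using assms by (simp add: continuous_action_def)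

lemma continuous_on_act:
  assumes "continuous_action act" and "continuous_on A f" and "continuous_on A g"
  shows "continuous_on A (\<lambda>p. act (f p) (g p))"
proof -
  have "continuous_on UNIV (\<lambda>(s, x). act s x)"
    using assms(1) by (simp add: continuous_action_def)
  from continuous_on_compose2[OF this continuous_on_Pair[OF assms(2,3)]] show ?thesis
    by simp
qed

lemma orbit_in_orbit:
  assumes "continuous_action act" and "y \<in> orbit act x"
  shows "act s y \<in> orbit act x"
  using assms by (auto simp: orbit_def act_assoc)

lemma orbit_closure_subset:
  assumes act: "continuous_action act" and y: "y \<in> closure (orbit act x)"
  shows "closure (orbit act y) \<subseteq> closure (orbit act x)"
proof (rule closure_minimal)
  have "act s y \<in> closure (orbit act x)" for s
  proof -
    have "act s ` closure (orbit act x) \<subseteq> closure (orbit act x)"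
    proof (rule image_closure_subset)
      show "continuous_on (closure (orbit act x)) (act s)"
        using continuous_on_act[OF act continuous_on_const continuous_on_id] by simp
      show "act s ` orbit act x \<subseteq> closure (orbit act x)"
        using orbit_in_orbit[OF act] closure_subset by blast
    qed simp
    with y show ?thesis by blast
  qed
  then show "orbit act y \<subseteq> closure (orbit act x)"
    by (auto simp: orbit_def)
qed simp

lemma minimal_on_subset_closure_orbit:
  assumes "minimal_on act Y" and "y \<in> Y"
  shows "Y \<subseteq> closure (orbit act y)"
proof -
  have "Y = Y \<inter> closure (Y \<inter> orbit act y)"
    using assms by (simp add: minimal_on_def closure_of_subtopology)
  also have "\<dots> \<subseteq> closure (orbit act y)"
    using closure_mono[of "Y \<inter> orbit act y" "orbit act y"] by blast
  finally show ?thesis .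
qed

text \<open>
  Compactness turns the pointwise statement "every point of \<open>M\<close> visits \<open>U\<close>" into one with
  finitely many visiting times.
\<close>

lemma compact_minimal_finite_return:
  assumes act: "continuous_action act" and M: "minimal_on act M" "compact M"
    and U: "open U" "M \<inter> U \<noteq> {}"
  obtains T where "finite T" and "\<And>m. m \<in> M \<Longrightarrow> \<exists>t\<in>T. act t m \<in> U"
proof -
  have opn: "open (act t -` U)" for t
    using continuous_on_act[OF act continuous_on_const continuous_on_id] U(1)
    by (intro open_vimage) auto
  have "M \<subseteq> (\<Union>t. act t -` U)"
  proof
    fix m assume "m \<in> M"
    then have "closure (orbit act m) \<inter> U \<noteq> {}"
      using minimal_on_subset_closure_orbit[OF M(1)] U(2) by blast
    then have "orbit act m \<inter> U \<noteq> {}"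
      using U(1) by (metis Int_commute open_Int_closure_eq_empty)
    then show "m \<in> (\<Union>t. act t -` U)"
      by (auto simp: orbit_def)
  qed
  then obtain T where "finite T" and T: "M \<subseteq> (\<Union>t\<in>T. act t -` U)"
    using compactE_image[OF M(2), of UNIV "\<lambda>t. act t -` U"] opn by auto
  have "\<exists>t\<in>T. act t m \<in> U" if "m \<in> M" for m
    using T that by blast
  with \<open>finite T\<close> show thesis
    by (rule that)
qed

section \<open>Shadowing by an equicontinuity point\<close>

lemma Eq_pointsE:
  assumes "x0 \<in> Eq_points act" and "\<epsilon> > 0"
  obtains \<delta> where "\<delta> > 0" and "\<And>x s. dist x0 x < \<delta> \<Longrightarrow> dist (act s x0) (act s x) < \<epsilon>"
  using assms unfolding Eq_points_def by blast

lemma Eq_point_orbit_dense: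
  assumes TT: "topologically_transitive act" and x0: "x0 \<in> Eq_points act"
  shows "closure (orbit act x0) = UNIV"
proof -
  have "u \<in> closure (orbit act x0)" for u
    unfolding closure_approachable
  proof (intro allI impI)
    fix e :: real assume "e > 0"
    then obtain d where "d > 0"
      and d: "\<And>x s. dist x0 x < d \<Longrightarrow> dist (act s x0) (act s x) < e / 2"
      using Eq_pointsE[OF x0, of "e / 2"] by auto
    have "ball u (e / 2) \<noteq> {}" "ball x0 d \<noteq> {}"
      using \<open>e > 0\<close> \<open>d > 0\<close> by auto
    then obtain s where "ball u (e / 2) \<inter> act s ` ball x0 d \<noteq> {}"
      using TT unfolding topologically_transitive_def by blast
    then obtain z where "dist u (act s z) < e / 2" "dist x0 z < d"
      by auto
    with d have "dist (act s x0) u < e"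
      by (metis dist_commute dist_triangle_half_r)
    then show "\<exists>y\<in>orbit act x0. dist y u < e"
      by (auto simp: orbit_def)
  qed
  then show ?thesis by blast
qed

text \<open>
  The shadowing is applied to the products \<open>t * s\<close>: for almost periodic \<open>a\<close> near \<open>x0\<close>, the
  return of \<open>s a\<close> under \<open>t\<close> forces that of \<open>s x0\<close> under the same \<open>t\<close>. In a semigroup without
  identity, \<open>a\<close> may lie outside its orbit closure \<open>M\<close>; but density of the orbit of \<open>x0\<close> gives
  \<open>s0\<close> with \<open>s0 x0\<close> near \<open>x0\<close>, and then \<open>s0 a\<close> is a point of \<open>M\<close> near \<open>x0\<close>.
\<close>

lemma Eq_point_finite_return:
  assumes act: "continuous_action act" and "M_system act"
    and x0: "x0 \<in> Eq_points act" and "e > 0"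
  obtains T where "finite T" and "\<And>x. \<exists>t\<in>T. dist x0 (act t x) \<le> e"
proof -
  have TT: "topologically_transitive act"
    and ap: "closure {x. almost_periodic act x} = UNIV"
    using \<open>M_system act\<close> by (auto simp: M_system_def)
  have dense: "closure (orbit act x0) = UNIV"
    using Eq_point_orbit_dense[OF TT x0] .
  (* One third for each of: the return of s0 x0, its shadowing by s0 a, the shadowing of t s x0. *)
  define r where "r = e / 3"
  have "r > 0"
    using \<open>e > 0\<close> by (simp add: r_def)
  then obtain d where "d > 0"
    and d: "\<And>x s. dist x0 x < d \<Longrightarrow> dist (act s x0) (act s x) < r"
    using Eq_pointsE[OF x0] by blast
  obtain a where "almost_periodic act a" "dist a x0 < d"
    using ap \<open>d > 0\<close> closure_approachable[of x0 "{x. almost_periodic act x}"] by auto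
  then have shadow: "dist (act s x0) (act s a) < r" for s
    using d by (simp add: dist_commute)
  define M where "M = closure (orbit act a)"
  have M: "minimal_on act M" "compact M"
    using \<open>almost_periodic act a\<close> by (auto simp: M_def almost_periodic_def)
  have in_M: "act s a \<in> M" for s
    using closure_subset[of "orbit act a"] by (auto simp: M_def orbit_def)
  obtain s0 where "dist (act s0 x0) x0 < r"
    using dense \<open>r > 0\<close> closure_approachable[of x0 "orbit act x0"] by (auto simp: orbit_def)
  then have "dist x0 (act s0 a) < 2 * r"
    using shadow[of s0] dist_triangle[of x0 "act s0 a" "act s0 x0"] by (simp add: dist_commute)
  then have "M \<inter> ball x0 (2 * r) \<noteq> {}"
    using in_M[of s0] by (metis IntI emptyE mem_ball)
  then obtain T where "finite T"
    and T: "\<And>m. m \<in> M \<Longrightarrow> \<exists>t\<in>T. act t m \<in> ball x0 (2 * r)"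
    using compact_minimal_finite_return[OF act M open_ball] by blast
  define R where "R = (\<Union>t\<in>T. act t -` cball x0 e)"
  have "orbit act x0 \<subseteq> R"
  proof
    fix y assume "y \<in> orbit act x0"
    then obtain s where y: "y = act s x0"
      by (auto simp: orbit_def)
    obtain t where "t \<in> T" and t: "dist x0 (act t (act s a)) < 2 * r"
      using T[OF in_M] by auto
    have "dist (act t (act s x0)) (act t (act s a)) < r"
      using shadow by (simp add: act_assoc[OF act])
    then have "dist x0 (act t y) \<le> e"
      using t dist_triangle2[of x0 "act t y" "act t (act s a)"] by (simp add: y r_def)
    with \<open>t \<in> T\<close> show "y \<in> R"
      by (auto simp: R_def)
  qed
  moreover have "closed R"
    unfolding R_def
  proof (intro closed_UN \<open>finite T\<close> ballI closed_vimage closed_cball)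
    show "continuous_on UNIV (act t)" for t
      using continuous_on_act[OF act continuous_on_const continuous_on_id] by simp
  qed
  ultimately have "R = UNIV"
    using closure_minimal[of "orbit act x0" R] dense by blast
  have "\<exists>t\<in>T. dist x0 (act t x) \<le> e" for x
  proof -
    have "x \<in> R"
      using \<open>R = UNIV\<close> by simp
    then show ?thesis
      by (simp add: R_def)
  qed
  with \<open>finite T\<close> show thesis
    by (rule that)
qed

lemma Eq_point_in_every_orbit_closure:
  assumes "continuous_action act" and "M_system act" and "x0 \<in> Eq_points act"
  shows "x0 \<in> closure (orbit act x)"
  unfolding closure_approachable
proof (intro allI impI)
  fix e :: real assume "e > 0"
  then obtain t where "dist x0 (act t x) \<le> e / 2"
    using Eq_point_finite_return[OF assms, of "e / 2"] by (metis half_gt_zero)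
  then show "\<exists>y\<in>orbit act x. dist y x0 < e"
    using \<open>e > 0\<close> by (intro bexI[of _ "act t x"]) (auto simp: orbit_def dist_commute)
qed

lemma M_system_Eq_point_minimal:
  assumes act: "continuous_action act" and M: "M_system act" and x0: "x0 \<in> Eq_points act"
  shows "minimal_system act"
proof -
  have "closure (orbit act x) = UNIV" for x
    using orbit_closure_subset[OF act Eq_point_in_every_orbit_closure[OF assms]]
      Eq_point_orbit_dense[OF _ x0] M
    by (auto simp: M_system_def)
  then show ?thesis
    by (simp add: minimal_on_def)
qed

section \<open>Spreading equicontinuity over the space\<close>

text \<open>
  A tube argument: joint continuity bounds the oscillation at \<open>x\<close> on a product neighbourhood of
  each \<open>(k, x)\<close>, and finitely many of these cover \<open>K\<close>.
\<close>

lemma compact_family_equicontinuous: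
  fixes act :: "'s::topological_semigroup_mult \<Rightarrow> 'x::metric_space \<Rightarrow> 'x"
  assumes act: "continuous_action act" and "compact K" and "e > 0"
  obtains V where "open V" and "x \<in> V"
    and "\<And>k y. k \<in> K \<Longrightarrow> y \<in> V \<Longrightarrow> dist (act k x) (act k y) < e"
proof -
  define W where "W = {p. dist (act (fst p) x) (act (fst p) (snd p)) < e}"
  have "open W"
    unfolding W_def
    by (intro open_Collect_less continuous_on_dist continuous_on_act[OF act]
        continuous_on_const continuous_on_fst continuous_on_snd continuous_on_id)
  have "\<exists>A B. open A \<and> open B \<and> k \<in> A \<and> x \<in> B \<and> A \<times> B \<subseteq> W" for k
  proof -
    have "(k, x) \<in> W"
      using \<open>e > 0\<close> by (simp add: W_def)
    then show ?thesis
      using \<open>open W\<close> by (metis open_prod_elim mem_Sigma_iff)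
  qed
  then obtain A B where AB: "\<And>k. open (A k)" "\<And>k. open (B k)" "\<And>k. k \<in> A k"
      "\<And>k. x \<in> B k" "\<And>k. A k \<times> B k \<subseteq> W"
    by metis
  obtain F where "finite F" and F: "K \<subseteq> (\<Union>k\<in>F. A k)"
  proof (rule compactE_image[OF \<open>compact K\<close>, of K A])
    show "K \<subseteq> (\<Union>k\<in>K. A k)"
      using AB(3) by blast
  qed (use AB(1) in simp_all)
  show thesis
  proof (rule that[of "\<Inter>k\<in>F. B k"])
    show "open (\<Inter>k\<in>F. B k)"
      using \<open>finite F\<close> AB(2) by (intro open_INT) auto
    show "x \<in> (\<Inter>k\<in>F. B k)"
      using AB(4) by blast
    show "dist (act k x) (act k y) < e" if "k \<in> K" "y \<in> (\<Inter>k\<in>F. B k)" for k y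
    proof -
      have "(k, y) \<in> W"
        using that F AB(5) by blast
      then show ?thesis
        by (simp add: W_def)
    qed
  qed
qed

text \<open>
  Split the semigroup into \<open>S * s\<close>, which factors through a neighbourhood of the equicontinuity
  point, and its complement, which lies in a compact set.
\<close>

lemma C_semigroup_Eq_points_pullback:
  fixes act :: "'s::topological_semigroup_mult \<Rightarrow> 'x::metric_space \<Rightarrow> 'x"
  assumes C: "C_semigroup TYPE('s)" and act: "continuous_action act"
    and x0: "x0 \<in> Eq_points act" and x: "x0 \<in> closure (orbit act x)"
  shows "x \<in> Eq_points act"
  unfolding Eq_points_def mem_Collect_eq
proof (intro allI impI)
  fix e :: real assume "e > 0"
  then obtain d where "d > 0"
    and d: "\<And>z s. dist x0 z < d \<Longrightarrow> dist (act s x0) (act s z) < e / 2"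
    using Eq_pointsE[OF x0, of "e / 2"] by auto
  obtain s where s: "dist x0 (act s x) < d"
    using x \<open>d > 0\<close> closure_approachable[of x0 "orbit act x"]
    by (auto simp: orbit_def dist_commute)
  define K where "K = closure (UNIV - range (\<lambda>t. t * s))"
  have "compact K"
    using C by (simp add: C_semigroup_def K_def)
  then obtain V where V: "open V" "x \<in> V"
    and VK: "\<And>k y. k \<in> K \<Longrightarrow> y \<in> V \<Longrightarrow> dist (act k x) (act k y) < e"
    using compact_family_equicontinuous[OF act _ \<open>e > 0\<close>] by blast
  define V' where "V' = V \<inter> act s -` ball x0 d"
  have "continuous_on UNIV (act s)"
    using continuous_on_act[OF act continuous_on_const continuous_on_id] by simp
  then have "open V'"
    using V(1) unfolding V'_def by (intro open_Int open_vimage open_ball)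
  moreover have "x \<in> V'"
    using V(2) s by (simp add: V'_def)
  ultimately obtain r where "r > 0" and r: "ball x r \<subseteq> V'"
    using open_contains_ball by blast
  have "dist (act t x) (act t y) < e" if "dist x y < r" for t y
  proof (cases "t \<in> range (\<lambda>t. t * s)")
    case True
    then obtain u where u: "t = u * s" by blast
    have "dist x0 (act s y) < d"
      using r that by (auto simp: V'_def)
    then have "dist (act u (act s x)) (act u (act s y)) < e"
      using d[OF s, of u] d[of "act s y" u] dist_triangle_half_r by blast
    then show ?thesis
      by (simp add: u act_assoc[OF act])
  next
    case False
    then have "t \<in> K"
      using closure_subset unfolding K_def by blast
    moreover have "y \<in> V"
      using r that by (auto simp: V'_def)
    ultimately show ?thesis
      using VK by blast
  qed
  with \<open>r > 0\<close> show "\<exists>r>0. \<forall>y. dist x y < r \<longrightarrow> (\<forall>t. dist (act t x) (act t y) < e)"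
    by blast
qed

section \<open>M-systems with an equicontinuity point\<close>

theorem theorem5p6:
  fixes act :: "'s::topological_semigroup_mult \<Rightarrow> 'x::metric_space \<Rightarrow> 'x"
  assumes "C_semigroup TYPE('s)"
    and "polish_topology (euclidean :: 'x topology)"
    and "continuous_action act"
    and "M_system act"
    and "Eq_points act \<noteq> {}"
  shows "minimal_system act \<and> equicontinuous_system act"
proof -
  obtain x0 where x0: "x0 \<in> Eq_points act"
    using assms(5) by blast
  have "Eq_points act = UNIV"
    using C_semigroup_Eq_points_pullback[OF assms(1,3) x0]
      Eq_point_in_every_orbit_closure[OF assms(3,4) x0] by blast
  then show ?thesis
    using M_system_Eq_point_minimal[OF assms(3,4) x0] by (simp add: equicontinuous_system_def)
qed

end
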